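(* Suppose that the modes share a common domain, $D(A_1)=\dots=D(A_N)$, and are non-expansive: $\|S_i(t)\|\le1$ for all $i\in\{1,\dots,N\}$ and $t\ge0$. The following statements are equivalent: (i) the switched system $\dot x(t)=A_{\eta(t)}x(t)$ is UGES over $\Sigma_{0,\infty}$ (arbitrary switching); (ii) there exist $p\ge1$, $c>0$ and a common functional $V:X\to\mathbb R_{\ge0}$, Lipschitz on bounded subsets of $X$, such that for all $x\in X$ $$V(x)\le c\|x\|^p\qquad\text{and}\qquad\underline D^+_iV(x)\le-\|x\|^p\quad\text{for every mode }i.$$ An explicit common functional witnessing (ii) (when (i) holds) is $$V(x):=\sup_\eta\int_0^\infty\|\Phi_\eta(t,0)x\|^p\,dt,$$ the supremum ranging over all admissible signals $\eta\in\Sigma_{0,\infty}$.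
   Context: Switched system. $X$ is a Banach space with norm $\|\cdot\|$ (the non-expansiveness is with respect to this norm, which may be a common equivalent renorming); $A_1,\dots,A_N$ generate $C_0$-semigroups $S_1,\dots,S_N$ on $X$. A switching signal $\eta:\mathbb R_{\ge0}\to\{1,\dots,N\}$ is piecewise constant and right-continuous; its discontinuities (switching instants) form a sequence $\{t_k\}_{k\ge1}$ with, setting $t_0:=0$, $t_{k+1}>t_k$ for $k\ge0$ and $t_k\to\infty$; $\eta\equiv i_k$ on $[t_k,t_{k+1})$ with $i_{k-1}\neq i_k$. $\Sigma_{0,\infty}$ is the family of all such signals, with no further constraint. $\Phi_\eta(t,s)$, $t\ge s\ge0$, is the evolution family of $\dot x=A_{\eta(t)}x$: it coincides with the active semigroup on each mode interval and is composed continuously across switches, i.e. $\Phi_\eta(t,s)=S_{i_m}(t-t_m)S_{i_{m-1}}(t_m-t_{m-1})\cdots S_{i_{l-1}}(t_l-s)$ if $t_l<\dots<t_m$ are the switching instants in $(s,t]$. UGES over a family $\Sigma$ of signals: there exist $M\ge1$, $\alpha\ge0$, $\rho\in(0,1]$ with $\alpha-\log\rho>0$ such that $\|\Phi_\eta(t,s)\|\le M\rho^{\kappa(t,s)}e^{-\alpha(t-s)}$ for all $t\ge s\ge0$ and $\eta\in\Sigma$, where $\kappa(t,s)$ is the number of switching instants of $\eta$ in $(s,t]$. $V$ is Lipschitz on bounded subsets if for every $r>0$ there is $L_r>0$ with $|V(x)-V(y)|\le L_r\|x-y\|$ whenever $\|x\|,\|y\|<r$. $\underline D^+_iV(x):=\liminf_{h\downarrow0}h^{-1}\big(V(S_i(h)x)-V(x)\big)$.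 *)

theory Defs
  imports "HOL-Analysis.Analysis"
begin

text \<open>
  The norm of \<^typ>\<open>'a \<Rightarrow>\<^sub>L 'a\<close> is the operator norm.
  Semigroups are indexed by \<^typ>\<open>real\<close>; their values at negative times are irrelevant.
\<close>

definition C0_semigroup :: "(real \<Rightarrow> 'a::banach \<Rightarrow>\<^sub>L 'a) \<Rightarrow> bool" where
  "C0_semigroup T \<longleftrightarrow>
     T 0 = id_blinfun \<and>
     (\<forall>s\<ge>0. \<forall>t\<ge>0. T (s + t) = T s o\<^sub>L T t) \<and>
     (\<forall>x. ((\<lambda>t. T t x) \<longlongrightarrow> x) (at_right 0))"

text \<open>An unbounded operator is given by its domain \<open>D\<close> and a function \<open>A\<close>,
  of which only the values on \<open>D\<close> matter.\<close>

definition generates ::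
  "'a set \<Rightarrow> ('a \<Rightarrow> 'a) \<Rightarrow> (real \<Rightarrow> 'a::banach \<Rightarrow>\<^sub>L 'a) \<Rightarrow> bool" where
  "generates D A T \<longleftrightarrow>
     C0_semigroup T \<and>
     D = {x. \<exists>y. ((\<lambda>h. (T h x - x) /\<^sub>R h) \<longlongrightarrow> y) (at_right 0)} \<and>
     (\<forall>x\<in>D. ((\<lambda>h. (T h x - x) /\<^sub>R h) \<longlongrightarrow> A x) (at_right 0))"

text \<open>
  All signals with values in \<open>{1..N}\<close>. As the modes of consecutive intervals differ,
  the discontinuities of \<open>\<eta>\<close> on \<open>{0..}\<close> are exactly the points \<open>\<tau> k\<close> with \<open>k \<ge> 1\<close>.
  There are infinitely many of them, so eventually constant signals do not belong
  to the class. Values of \<open>\<eta>\<close> at negative times are irrelevant.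
\<close>

definition signals :: "nat \<Rightarrow> (real \<Rightarrow> nat) set" where
  "signals N = {\<eta>. \<exists>(\<tau> :: nat \<Rightarrow> real) (i :: nat \<Rightarrow> nat).
     \<tau> 0 = 0 \<and> (\<forall>k. \<tau> k < \<tau> (Suc k)) \<and> filterlim \<tau> at_top sequentially \<and>
     (\<forall>k. i k \<in> {1..N}) \<and> (\<forall>k. i k \<noteq> i (Suc k)) \<and>
     (\<forall>k. \<forall>t\<in>{\<tau> k..<\<tau> (Suc k)}. \<eta> t = i k)}"

definition switching_instants :: "(real \<Rightarrow> nat) \<Rightarrow> real set" where
  "switching_instants \<eta> = {t\<in>{0..}. \<not> continuous (at t within {0..}) \<eta>}"

definition switch_count :: "(real \<Rightarrow> nat) \<Rightarrow> real \<Rightarrow> real \<Rightarrow> nat" where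
  "switch_count \<eta> t s = card (switching_instants \<eta> \<inter> {s<..t})"

text \<open>\<open>compose_modes S \<eta> t s ts\<close> runs from time \<open>s\<close> to time \<open>t\<close>, where \<open>ts\<close> lists the
  switching instants in between in increasing order. By right continuity, the mode
  active from \<open>s\<close> until the next switch is \<open>\<eta> s\<close>.\<close>

fun compose_modes ::
  "(nat \<Rightarrow> real \<Rightarrow> 'a::banach \<Rightarrow>\<^sub>L 'a) \<Rightarrow> (real \<Rightarrow> nat) \<Rightarrow> real \<Rightarrow> real \<Rightarrow> real list
     \<Rightarrow> 'a \<Rightarrow>\<^sub>L 'a" where
  "compose_modes S \<eta> t s [] = S (\<eta> s) (t - s)"
| "compose_modes S \<eta> t s (u # us) = compose_modes S \<eta> t u us o\<^sub>L S (\<eta> s) (u - s)"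

definition evolution ::
  "(nat \<Rightarrow> real \<Rightarrow> 'a::banach \<Rightarrow>\<^sub>L 'a) \<Rightarrow> (real \<Rightarrow> nat) \<Rightarrow> real \<Rightarrow> real \<Rightarrow> 'a \<Rightarrow>\<^sub>L 'a" where
  "evolution S \<eta> t s =
     compose_modes S \<eta> t s (sorted_list_of_set (switching_instants \<eta> \<inter> {s<..t}))"

definition UGES ::
  "(nat \<Rightarrow> real \<Rightarrow> 'a::banach \<Rightarrow>\<^sub>L 'a) \<Rightarrow> (real \<Rightarrow> nat) set \<Rightarrow> bool" where
  "UGES S \<Sigma> \<longleftrightarrow>
     (\<exists>M \<alpha> \<rho> :: real. M \<ge> 1 \<and> \<alpha> \<ge> 0 \<and> 0 < \<rho> \<and> \<rho> \<le> 1 \<and> \<alpha> - ln \<rho> > 0 \<and>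
        (\<forall>\<eta>\<in>\<Sigma>. \<forall>s t. 0 \<le> s \<and> s \<le> t \<longrightarrow>
           norm (evolution S \<eta> t s) \<le> M * \<rho> ^ switch_count \<eta> t s * exp (- \<alpha> * (t - s))))"

definition lipschitz_on_bounded :: "('a::real_normed_vector \<Rightarrow> real) \<Rightarrow> bool" where
  "lipschitz_on_bounded V \<longleftrightarrow> (\<forall>r>0. \<exists>L>0. L-lipschitz_on (ball 0 r) V)"

definition lower_dini ::
  "(real \<Rightarrow> 'a::banach \<Rightarrow>\<^sub>L 'a) \<Rightarrow> ('a \<Rightarrow> real) \<Rightarrow> 'a \<Rightarrow> ereal" where
  "lower_dini T V x = Liminf (at_right 0) (\<lambda>h. ereal ((V (T h x) - V x) / h))"

definition common_functional ::
  "nat \<Rightarrow> (nat \<Rightarrow> real \<Rightarrow> 'a::banach \<Rightarrow>\<^sub>L 'a) \<Rightarrow> real \<Rightarrow> real \<Rightarrow> ('a \<Rightarrow> real) \<Rightarrow> bool" where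
  "common_functional N S p c V \<longleftrightarrow>
     (\<forall>x. 0 \<le> V x) \<and> lipschitz_on_bounded V \<and>
     (\<forall>x. V x \<le> c * norm x powr p) \<and>
     (\<forall>x. \<forall>i\<in>{1..N}. lower_dini (S i) V x \<le> ereal (- (norm x powr p)))"

definition sup_functional ::
  "nat \<Rightarrow> (nat \<Rightarrow> real \<Rightarrow> 'a::banach \<Rightarrow>\<^sub>L 'a) \<Rightarrow> real \<Rightarrow> 'a \<Rightarrow> ennreal" where
  "sup_functional N S p x =
     (SUP \<eta>\<in>signals N. \<integral>\<^sup>+t\<in>{0..}. ennreal (norm (evolution S \<eta> t 0 x) powr p) \<partial>lborel)"

end

theory Submission imports Defs begin

text \<open>
  Suppose first that a common functional \<open>V\<close> with exponent \<open>p\<close> and bound \<open>c\<close> is given, and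
  let \<open>z\<close> be the value at time \<open>T\<close> of the trajectory of one mode that starts in \<open>x\<close>. By non-expansiveness
  the norm along the trajectory stays above the norm of \<open>z\<close>, so that with \<open>\<alpha> = 1 / (2 * c)\<close> the
  function \<open>exp (\<alpha> * t) * (V (x t) + c * norm z powr p)\<close> has a non-positive lower right Dini
  derivative: the growth of the exponential contributes at most
  \<open>\<alpha> * (c + c) * norm (x t) powr p = norm (x t) powr p\<close>, which the decrease of \<open>V\<close> cancels. A
  continuous function with this property is nonincreasing (\<open>nonincreasing_of_lower_dini\<close>), so
  \<open>exp (\<alpha> * T) * (V z + c * norm z powr p) \<le> V x + c * norm z powr p\<close>. This estimate composes
  across switches (\<open>evolution_weighted_decrease\<close>). Adding the constant term is what replaces a
  lower bound on \<open>V\<close>: as \<open>V z \<ge> 0\<close> and \<open>norm z \<le> norm x\<close>, it gives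
  \<open>exp (\<alpha> * T) * norm z powr p \<le> 2 * norm x powr p\<close>, which is uniform exponential decay.

  Conversely, uniform stability yields a decay in time alone. This is immediate unless its
  time rate vanishes, and then it bounds the evolution by a power of some \<open>\<rho> < 1\<close> that counts
  the switches. By strong continuity, arbitrarily many switches within a short enough time
  hardly move a given point, so that the space must be trivial (\<open>switch_decay_imp_trivial\<close>).
  Given decay in time, the worst-case cost is finite, and Lipschitz on balls because
  \<open>u powr p\<close> is. It decreases along every mode \<open>j\<close> since any admissible signal may be preceded
  by a run of \<open>j\<close> of length \<open>h\<close> (\<open>delay_in_signals\<close>, \<open>cost_delay_ge\<close>): optimality and
  non-expansiveness give \<open>V (S j h x) + h * norm (S j h x) powr p \<le> V x\<close>.
\<close>

section \<open>Real-variable preliminaries\<close>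

text \<open>
  The hypothesis says that the lower right Dini derivative is at most \<open>0\<close> everywhere. For
  \<open>\<epsilon> > 0\<close> consider the last point \<open>m\<close> at which \<open>f\<close> lies on or below the line of slope \<open>\<epsilon>\<close>
  through the initial point of its graph. If \<open>m < b\<close>, then \<open>f\<close> lies above this line to the
  right of \<open>m\<close>, so all difference quotients at \<open>m\<close> exceed \<open>\<epsilon>\<close>, which is excluded.
\<close>

lemma nonincreasing_of_lower_dini:
  fixes f :: "real \<Rightarrow> real"
  assumes ab: "a \<le> b" and cont: "continuous_on {a..b} f"
    and dini: "\<And>t \<epsilon>. a \<le> t \<Longrightarrow> t < b \<Longrightarrow> 0 < \<epsilon> \<Longrightarrow> \<exists>\<^sub>F h in at_right 0. f (t + h) \<le> f t + \<epsilon> * h"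
  shows "f b \<le> f a"
proof -
  have slope: "f b \<le> f a + \<epsilon> * (b - a)" if \<epsilon>: "0 < \<epsilon>" for \<epsilon>
  proof (rule ccontr)
    assume neg: "\<not> ?thesis"
    define K where "K = {t\<in>{a..b}. f t \<le> f a + \<epsilon> * (t - a)}"
    have "closed K" unfolding K_def
      by (intro continuous_on_closed_Collect_le continuous_intros cont closed_atLeastAtMost)
    then have "compact K"
      by (metis (no_types, lifting) K_def bounded_closed_interval bounded_subset compact_eq_bounded_closed mem_Collect_eq subsetI)
    moreover have "a \<in> K" using ab by (simp add: K_def)
    ultimately obtain m where m: "m \<in> K" "\<And>t. t \<in> K \<Longrightarrow> t \<le> m"
      using compact_attains_sup[of K] by blast
    have "m \<noteq> b" using m(1) neg by (auto simp: K_def)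
    then have mb: "a \<le> m" "m < b" using m(1) by (auto simp: K_def)
    have above: "f m + \<epsilon> * h < f (m + h)" if "0 < h" "h < b - m" for h
    proof -
      have "m + h \<notin> K" using m(2)[of "m + h"] that by auto
      then have "f a + \<epsilon> * (m + h - a) < f (m + h)" using that mb by (auto simp: K_def)
      moreover have "f m \<le> f a + \<epsilon> * (m - a)" using m(1) by (simp add: K_def)
      ultimately show ?thesis by (simp add: algebra_simps)
    qed
    have "\<forall>\<^sub>F h in at_right 0. h < b - m"
      using mb by (intro order_tendstoD(2)[OF tendsto_ident_at]) auto
    moreover have "\<forall>\<^sub>F h::real in at_right 0. 0 < h" by (simp add: eventually_at_right_less)
    ultimately have "\<forall>\<^sub>F h in at_right 0. \<not> f (m + h) \<le> f m + \<epsilon> * h"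
      by eventually_elim (use above in force)
    then show False using dini[OF mb \<epsilon>] by (simp add: frequently_def)
  qed
  show ?thesis
  proof (rule field_le_epsilon)
    fix e :: real assume "0 < e"
    then have "f b \<le> f a + e / (b - a + 1) * (b - a)" using ab by (intro slope) simp
    also have "e / (b - a + 1) * (b - a) \<le> e"
      using ab \<open>0 < e\<close> by (simp add: field_simps)
    finally show "f b \<le> f a + e" by simp
  qed
qed

lemma frequently_less_of_Liminf:
  fixes f :: "'a \<Rightarrow> real"
  assumes "Liminf F (\<lambda>h. ereal (f h)) \<le> ereal C" "C < D"
  shows "\<exists>\<^sub>F h in F. f h < D"
proof (rule ccontr)
  assume "\<not> ?thesis"
  then have "\<forall>\<^sub>F h in F. ereal D \<le> ereal (f h)" by (simp add: frequently_def not_less)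
  then have "ereal D \<le> Liminf F (\<lambda>h. ereal (f h))" by (rule Liminf_bounded)
  with assms show False by (metis ereal_less_eq(3) leD order_trans)
qed

text \<open>
  By the mean value theorem, as the derivative of \<open>x powr p\<close> is monotone for \<open>p \<ge> 1\<close>. Only the
  larger of the two points matters when the difference is positive, so \<open>b\<close> may exceed \<open>r\<close>.
\<close>

lemma powr_le_add_linear:
  fixes a b r p :: real
  assumes "1 \<le> p" "0 \<le> a" "a \<le> r" "0 \<le> b"
  shows "a powr p \<le> b powr p + p * r powr (p - 1) * \<bar>a - b\<bar>"
proof (cases "b < a")
  case False
  then have "a powr p \<le> b powr p" using assms by (intro powr_mono2) auto
  moreover have "0 \<le> p * r powr (p - 1) * \<bar>a - b\<bar>" using assms by simp
  ultimately show ?thesis by linarith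
next
  case True
  have "continuous_on {b..a} (\<lambda>x. x powr p)"
    using assms by (intro continuous_on_powr' continuous_intros) auto
  moreover have "((\<lambda>x. x powr p) has_real_derivative p * x powr (p - 1)) (at x)" if "b < x" for x
    using that assms by (intro has_real_derivative_powr) auto
  ultimately obtain z where z: "b < z" "z < a" "a powr p - b powr p = (a - b) * (p * z powr (p - 1))"
    using MVT[OF True, of "\<lambda>x. x powr p"] by (metis DERIV_unique real_differentiable_def)
  have "z powr (p - 1) \<le> r powr (p - 1)" using z assms by (intro powr_mono2) auto
  then have "(a - b) * (p * z powr (p - 1)) \<le> (a - b) * (p * r powr (p - 1))"
    using True assms by (intro mult_left_mono) auto
  then show ?thesis using z True by (simp add: algebra_simps)
qed

lemma nn_integral_exp_decay:
  assumes "0 < \<alpha>" "0 \<le> C"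
  shows "(\<integral>\<^sup>+t\<in>{0..}. ennreal (C * exp (- \<alpha> * t)) \<partial>lborel) = ennreal (C / \<alpha>)"
proof -
  have lim: "((\<lambda>t. - (C / \<alpha>) * exp (- \<alpha> * t)) \<longlongrightarrow> - (C / \<alpha>) * 0) at_top"
    using assms by (intro tendsto_intros filterlim_compose[OF exp_at_bot])
      (auto simp: filterlim_uminus_at_bot intro!: filterlim_tendsto_pos_mult_at_top[OF tendsto_const] filterlim_ident)
  have "(\<integral>\<^sup>+t\<in>{0..}. ennreal (C * exp (- \<alpha> * t)) \<partial>lborel) = ennreal (0 - (- (C / \<alpha>) * exp (- \<alpha> * 0)))"
    using lim assms
    by (intro nn_integral_FTC_atLeast[where F = "\<lambda>t. - (C / \<alpha>) * exp (- \<alpha> * t)"])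
      (auto intro!: derivative_eq_intros)
  then show ?thesis by simp
qed

section \<open>Switching signals\<close>

text \<open>
  The body of \<open>signals\<close> with the switching times and modes as parameters, so that they can be
  referred to.
\<close>

definition realizes :: "nat \<Rightarrow> (real \<Rightarrow> nat) \<Rightarrow> (nat \<Rightarrow> real) \<Rightarrow> (nat \<Rightarrow> nat) \<Rightarrow> bool" where
  "realizes N \<eta> \<tau> i \<longleftrightarrow>
     \<tau> 0 = 0 \<and> (\<forall>k. \<tau> k < \<tau> (Suc k)) \<and> filterlim \<tau> at_top sequentially \<and>
     (\<forall>k. i k \<in> {1..N}) \<and> (\<forall>k. i k \<noteq> i (Suc k)) \<and>
     (\<forall>k. \<forall>t\<in>{\<tau> k..<\<tau> (Suc k)}. \<eta> t = i k)"

lemma signals_iff_realizes: "\<eta> \<in> signals N \<longleftrightarrow> (\<exists>\<tau> i. realizes N \<eta> \<tau> i)"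
  by (simp add: signals_def realizes_def)

context
  fixes N \<eta> \<tau> i assumes real: "realizes N \<eta> \<tau> i"
begin

lemma realizes_strict_mono: "strict_mono \<tau>"
  using real by (simp add: realizes_def strict_mono_Suc_iff)

lemma realizes_nonneg: "0 \<le> \<tau> k"
  using real strict_mono_mono[OF realizes_strict_mono] by (metis le0 monoD realizes_def)

lemma realizes_cover:
  assumes "0 \<le> t"
  obtains k where "\<tau> k \<le> t" "t < \<tau> (Suc k)"
proof -
  have "\<exists>n. t < \<tau> n"
    using real unfolding realizes_def filterlim_at_top_dense
    by (meson eventually_sequentially order_refl)
  then have L: "t < \<tau> (LEAST n. t < \<tau> n)" by (rule LeastI_ex)
  then have "(LEAST n. t < \<tau> n) \<noteq> 0" using assms real by (metis leD realizes_def)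
  then obtain k where k: "(LEAST n. t < \<tau> n) = Suc k" using not0_implies_Suc by blast
  then have "\<not> t < \<tau> k" by (intro not_less_Least) simp
  then show thesis using that k L by force
qed

lemma realizes_value: "\<tau> k \<le> t \<Longrightarrow> t < \<tau> (Suc k) \<Longrightarrow> \<eta> t = i k"
  using real by (auto simp: realizes_def)

lemma realizes_mode: "0 \<le> t \<Longrightarrow> \<eta> t \<in> {1..N}"
  by (metis real realizes_cover realizes_def realizes_value)

end

lemma continuous_within_nat_iff:
  fixes \<eta> :: "real \<Rightarrow> nat"
  shows "continuous (at t within A) \<eta> \<longleftrightarrow> (\<forall>\<^sub>F u in at t within A. \<eta> u = \<eta> t)"
  by (simp add: continuous_within tendsto_discrete)

lemma at_within_nonneg: "0 < t \<Longrightarrow> at t within {0..} = at (t::real)"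
  by (rule at_within_interior) simp

lemma not_switching_within_constant:
  assumes const: "\<And>u. s \<le> u \<Longrightarrow> u < v \<Longrightarrow> \<eta> u = j" and "0 \<le> s" "s < t" "t < v"
  shows "t \<notin> switching_instants \<eta>"
proof -
  have "\<forall>\<^sub>F u in at t. u \<in> {s<..<v}"
    using assms by (intro eventually_at_in_open') auto
  then have "\<forall>\<^sub>F u in at t. \<eta> u = \<eta> t"
    by eventually_elim (use const assms in auto)
  then show ?thesis
    using assms by (simp add: switching_instants_def continuous_within_nat_iff at_within_nonneg)
qed

text \<open>
  A point where a run of mode \<open>j\<close> ends is a switch unless the run continues through it. At a
  point of continuity the value thus has to be \<open>j\<close>, even though only the values before it are
  prescribed.
\<close>

lemma not_switching_right_end:
  assumes const: "\<And>u. s \<le> u \<Longrightarrow> u < t \<Longrightarrow> \<eta> u = j" and "0 \<le> s" "s < t"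
    and "t \<notin> switching_instants \<eta>"
  shows "\<eta> t = j"
proof -
  have "\<forall>\<^sub>F u in at t. \<eta> u = \<eta> t"
    using assms by (simp add: switching_instants_def continuous_within_nat_iff at_within_nonneg)
  then have "\<forall>\<^sub>F u in at_left t. \<eta> u = \<eta> t"
    by (simp add: eventually_at_split)
  moreover have "\<forall>\<^sub>F u in at_left t. u \<in> {s<..<t}"
    using eventually_at_left_real[OF \<open>s < t\<close>] .
  ultimately have "\<forall>\<^sub>F u in at_left t. \<eta> t = j"
    by eventually_elim (use const in auto)
  then show ?thesis by simp
qed

lemma switching_instants_eq:
  assumes "realizes N \<eta> \<tau> i"
  shows "switching_instants \<eta> = \<tau> ` {1..}"
proof (intro equalityI subsetI)
  fix t assume t: "t \<in> switching_instants \<eta>"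
  then have "0 \<le> t" by (simp add: switching_instants_def)
  then obtain k where k: "\<tau> k \<le> t" "t < \<tau> (Suc k)" using realizes_cover[OF assms] by blast
  have "\<tau> k = t"
  proof (rule ccontr)
    assume "\<tau> k \<noteq> t"
    then have "t \<notin> switching_instants \<eta>"
      using k realizes_value[OF assms, of k] realizes_nonneg[OF assms, of k]
      by (intro not_switching_within_constant[of "\<tau> k" "\<tau> (Suc k)" _ "i k"]) auto
    then show False using t by simp
  qed
  moreover have "k \<noteq> 0"
  proof
    assume "k = 0"
    then have t0: "t = 0" "0 < \<tau> 1" using assms \<open>\<tau> k = t\<close> by (auto simp: realizes_def One_nat_def) (metis One_nat_def)
    have "\<forall>\<^sub>F u in at_right 0. u < \<tau> 1" using t0 by (intro order_tendstoD(2)[OF tendsto_ident_at]) auto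
    moreover have "\<forall>\<^sub>F u::real in at_right 0. 0 < u" by (simp add: eventually_at_right_less)
    moreover have first: "\<eta> u = i 0" if "0 \<le> u" "u < \<tau> 1" for u
      using realizes_value[OF assms, of 0 u] assms that by (simp add: realizes_def)
    ultimately have "\<forall>\<^sub>F u in at_right 0. \<eta> u = i 0"
      by (auto elim: eventually_elim2)
    then have "\<forall>\<^sub>F u in at_right 0. \<eta> u = \<eta> 0" using first[of 0] t0 by simp
    then have "continuous (at 0 within {0..}) \<eta>"
      by (simp add: continuous_within_nat_iff at_within_Ici_at_right)
    then show False using t t0 by (simp add: switching_instants_def)
  qed
  ultimately show "t \<in> \<tau> ` {1..}" by force
next
  fix t assume "t \<in> \<tau> ` {1..}"
  then obtain m where "t = \<tau> m" "1 \<le> m" by auto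
  then obtain k where k: "t = \<tau> (Suc k)" by (cases m) auto
  have less: "\<tau> n < \<tau> (Suc n)" "i n \<noteq> i (Suc n)" for n using assms by (auto simp: realizes_def)
  show "t \<in> switching_instants \<eta>"
  proof (rule ccontr)
    assume "t \<notin> switching_instants \<eta>"
    then have "\<eta> t = i k"
      using k realizes_value[OF assms, of k] realizes_nonneg[OF assms, of k] less(1)[of k]
      by (intro not_switching_right_end[of "\<tau> k" t \<eta> "i k"]) auto
    moreover have "\<eta> t = i (Suc k)" using k less(1) realizes_value[OF assms, of "Suc k"] by simp
    ultimately show False using less(2)[of k] by simp
  qed
qed

lemma finite_switching:
  assumes "\<eta> \<in> signals N"
  shows "finite (switching_instants \<eta> \<inter> {s<..t})"
proof -
  obtain \<tau> i where r: "realizes N \<eta> \<tau> i" using assms by (auto simp: signals_iff_realizes)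
  then obtain n where n: "\<And>m. n \<le> m \<Longrightarrow> t < \<tau> m"
    unfolding realizes_def filterlim_at_top_dense by (meson eventually_sequentially)
  have "switching_instants \<eta> \<inter> {s<..t} \<subseteq> \<tau> ` {..<n}"
    using n by (force simp: switching_instants_eq[OF r] not_less[symmetric])
  then show ?thesis by (rule finite_subset) simp
qed

section \<open>Prepending a run of one mode\<close>

definition delay :: "nat \<Rightarrow> real \<Rightarrow> (real \<Rightarrow> nat) \<Rightarrow> real \<Rightarrow> nat" where
  "delay j h \<eta> t = (if t < h then j else \<eta> (t - h))"

text \<open>
  The new mode is either different from the first mode of the signal, and then \<open>h\<close> becomes a
  switching time, or equal to it, and then the first run merely becomes longer. The two cases
  need different switching times.
\<close>

lemma delay_in_signals:
  assumes "\<eta> \<in> signals N" "j \<in> {1..N}" "0 < h"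
  shows "delay j h \<eta> \<in> signals N"
proof -
  obtain \<tau> i where r: "realizes N \<eta> \<tau> i" using assms by (auto simp: signals_iff_realizes)
  then have "\<tau> 0 = 0" by (simp add: realizes_def)
  have lim: "filterlim (\<lambda>k. \<tau> k + h) at_top sequentially"
    using r filterlim_tendsto_add_at_top[OF tendsto_const[of h], of \<tau> sequentially]
    by (simp add: realizes_def add.commute)
  note val = realizes_value[OF r] realizes_nonneg[OF r]
  show ?thesis
  proof (cases "j = i 0")
    case True
    define \<tau>' where "\<tau>' k = (if k = 0 then 0 else \<tau> k + h)" for k
    have "filterlim \<tau>' at_top sequentially"
      by (rule filterlim_cong[THEN iffD1, OF refl refl _ lim])
        (auto simp: \<tau>'_def eventually_sequentially intro!: exI[of _ 1])
    moreover have "delay j h \<eta> t = i k" if "\<tau>' k \<le> t" "t < \<tau>' (Suc k)" for k t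
    proof (cases "t < h")
      case True
      then have "k = 0" using that val(2)[of k] by (auto simp: \<tau>'_def split: if_splits)
      then show ?thesis using True \<open>j = i 0\<close> by (simp add: delay_def)
    next
      case False
      then show ?thesis using that val(1)[of k "t - h"] \<open>\<tau> 0 = 0\<close>
        by (auto simp: \<tau>'_def delay_def split: if_splits)
    qed
    moreover have "\<tau>' k < \<tau>' (Suc k)" for k
      using r assms val(2)[of "Suc k"] by (auto simp: \<tau>'_def realizes_def)
    ultimately have "realizes N (delay j h \<eta>) \<tau>' i"
      using r by (auto simp: realizes_def \<tau>'_def)
    then show ?thesis by (auto simp: signals_iff_realizes)
  next
    case False
    define \<tau>' where "\<tau>' k = (case k of 0 \<Rightarrow> 0 | Suc n \<Rightarrow> \<tau> n + h)" for k
    define i' where "i' k = (case k of 0 \<Rightarrow> j | Suc n \<Rightarrow> i n)" for k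
    have "filterlim \<tau>' at_top sequentially"
      by (subst filterlim_sequentially_Suc[symmetric]) (simp add: \<tau>'_def lim)
    moreover have "delay j h \<eta> t = i' k" if "\<tau>' k \<le> t" "t < \<tau>' (Suc k)" for k t
      using that val(1)[of "k - 1" "t - h"] val(2)[of "k - 1"] \<open>\<tau> 0 = 0\<close>
      by (cases k) (auto simp: \<tau>'_def i'_def delay_def)
    moreover have "\<tau>' k < \<tau>' (Suc k)" "i' k \<noteq> i' (Suc k)" "i' k \<in> {1..N}" for k
      using r assms False by (cases k; auto simp: \<tau>'_def i'_def realizes_def)+
    ultimately have "realizes N (delay j h \<eta>) \<tau>' i'"
      using r by (auto simp: realizes_def \<tau>'_def)
    then show ?thesis by (auto simp: signals_iff_realizes)
  qed
qed

lemma switching_instants_delay: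
  assumes "0 < h"
  shows "switching_instants (delay j h \<eta>) \<inter> {h<..t + h} = (\<lambda>u. u + h) ` (switching_instants \<eta> \<inter> {0<..t})"
proof -
  have iff: "u + h \<in> switching_instants (delay j h \<eta>) \<longleftrightarrow> u \<in> switching_instants \<eta>" if "0 < u" for u
  proof -
    \<comment> \<open>Continuity at a positive time is a local property, so the prepended run does not affect it.\<close>
    have "\<forall>\<^sub>F v in nhds u. 0 < v" using that by (intro eventually_nhds_in_open[of "{0<..}", simplified]) auto
    then have "\<forall>\<^sub>F v in at u. delay j h \<eta> (v + h) = \<eta> v"
      unfolding eventually_at_filter by eventually_elim (auto simp: delay_def)
    then have "(\<forall>\<^sub>F v in at u. delay j h \<eta> (v + h) = \<eta> u) \<longleftrightarrow> (\<forall>\<^sub>F v in at u. \<eta> v = \<eta> u)"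
      by (intro eventually_subst, eventually_elim) simp
    moreover have "(\<forall>\<^sub>F v in at (u + h). delay j h \<eta> v = \<eta> u) \<longleftrightarrow> (\<forall>\<^sub>F v in at u. delay j h \<eta> (v + h) = \<eta> u)"
      using eventually_at_to_0[of _ "u + h"] eventually_at_to_0[of _ "u"] by (simp add: add.assoc)
    ultimately show ?thesis
      using that assms
      by (simp add: switching_instants_def continuous_within_nat_iff at_within_nonneg) (simp add: delay_def)
  qed
  show ?thesis
  proof (intro set_eqI iffI)
    fix v assume "v \<in> switching_instants (delay j h \<eta>) \<inter> {h<..t + h}"
    then have "v - h \<in> switching_instants \<eta> \<inter> {0<..t}" using iff[of "v - h"] by auto
    then show "v \<in> (\<lambda>u. u + h) ` (switching_instants \<eta> \<inter> {0<..t})" by force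
  qed (use iff in auto)
qed


section \<open>Alternating signals\<close>

text \<open>
  A switch between the modes \<open>1\<close> and \<open>2\<close> at each multiple of \<open>h\<close>. These signals show that the class is
  nonempty and contains signals with arbitrarily many switches in a short time.
\<close>

definition alternating :: "real \<Rightarrow> real \<Rightarrow> nat" where
  "alternating h t = (if even \<lfloor>t / h\<rfloor> then 1 else 2)"

lemma alternating_realizes:
  assumes "2 \<le> N" "0 < h"
  shows "realizes N (alternating h) (\<lambda>k. real k * h) (\<lambda>k. if even k then 1 else 2)"
  unfolding realizes_def
proof (intro conjI allI ballI)
  show "filterlim (\<lambda>k. real k * h) at_top sequentially"
    using filterlim_tendsto_pos_mult_at_top[OF tendsto_const \<open>0 < h\<close> filterlim_real_sequentially]
    by (simp add: mult.commute)
  fix k t assume "t \<in> {real k * h..<real (Suc k) * h}"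
  then have "real k \<le> t / h" "t / h < real k + 1" using assms by (auto simp: field_simps)
  then have "\<lfloor>t / h\<rfloor> = int k" by (intro floor_unique) auto
  then show "alternating h t = (if even k then 1 else 2)" by (simp add: alternating_def)
qed (use assms in auto)

section \<open>Evolution families of non-expansive modes\<close>

lemma compose_modes_delay:
  assumes "0 \<le> s" "\<forall>u\<in>set ts. 0 \<le> u"
  shows "compose_modes S (delay j h \<eta>) (t + h) (s + h) (map (\<lambda>u. u + h) ts) = compose_modes S \<eta> t s ts"
  using assms by (induction ts arbitrary: s) (auto simp: delay_def)

lemma sorted_list_of_set_translation:
  "sorted_list_of_set ((\<lambda>u. u + h) ` A) = map (\<lambda>u. u + h) (sorted_list_of_set (A :: real set))"
proof (cases "finite A")
  case True
  have "sorted (map (\<lambda>u. u + h) (sorted_list_of_set A))" by (simp add: sorted_map)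
  moreover have "distinct (map (\<lambda>u. u + h) (sorted_list_of_set A))" by (simp add: distinct_map inj_on_def)
  ultimately show ?thesis
    using True by (intro sorted_distinct_set_unique) simp_all
next
  case False
  then have "infinite ((\<lambda>u. u + h) ` A)" by (simp add: finite_image_iff)
  then show ?thesis using False by simp
qed

lemma evolution_delay_tail:
  assumes "0 < h"
  shows "evolution S (delay j h \<eta>) (t + h) h = evolution S \<eta> t 0"
proof -
  let ?ts = "sorted_list_of_set (switching_instants \<eta> \<inter> {0<..t})"
  have "\<forall>u\<in>set ?ts. 0 \<le> u"
    by (cases "finite (switching_instants \<eta> \<inter> {0<..t})") auto
  then have "compose_modes S (delay j h \<eta>) (t + h) (0 + h) (map (\<lambda>u. u + h) ?ts) = compose_modes S \<eta> t 0 ?ts"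
    by (intro compose_modes_delay) auto
  then show ?thesis
    by (simp add: evolution_def switching_instants_delay[OF assms] sorted_list_of_set_translation)
qed

lemma blinfun_compose_assoc: "(A o\<^sub>L B) o\<^sub>L C = A o\<^sub>L (B o\<^sub>L C)"
  by (intro blinfun_eqI) simp

lemma C0_semigroup_add:
  "C0_semigroup T \<Longrightarrow> 0 \<le> s \<Longrightarrow> 0 \<le> t \<Longrightarrow> T (s + t) = T s o\<^sub>L T t"
  by (simp add: C0_semigroup_def)

lemma C0_semigroup_zero: "C0_semigroup T \<Longrightarrow> T 0 = id_blinfun"
  by (simp add: C0_semigroup_def)

text \<open>
  For contractions, strong continuity at \<open>0\<close> spreads to all times, from the left as well as from
  the right, because \<open>T t x - T s x\<close> is the image of \<open>T (t - s) x - x\<close> under \<open>T s\<close>.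
\<close>

lemma C0_semigroup_continuous:
  assumes T: "C0_semigroup T" and contr: "\<And>t. 0 \<le> t \<Longrightarrow> norm (T t) \<le> 1"
  shows "continuous_on {0..} (\<lambda>t. T t x)"
proof -
  have incr: "dist (T t x) (T s x) \<le> dist (T (t - s) x) x" if "0 \<le> s" "s \<le> t" for s t
  proof -
    have "T t x - T s x = T s (T (t - s) x - x)"
      using C0_semigroup_add[OF T, of s "t - s"] that by (simp add: blinfun.diff_right)
    then have "dist (T t x) (T s x) \<le> norm (T s) * dist (T (t - s) x) x"
      by (simp add: dist_norm norm_blinfun)
    also have "\<dots> \<le> 1 * dist (T (t - s) x) x"
      using contr that by (intro mult_right_mono) auto
    finally show ?thesis by simp
  qed
  show ?thesis
    unfolding continuous_on_iff
  proof (intro ballI allI impI)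
    fix t e :: real assume t: "t \<in> {0..}" and "0 < e"
    have "((\<lambda>t. T t x) \<longlongrightarrow> x) (at_right 0)" using T by (simp add: C0_semigroup_def)
    then have "\<forall>\<^sub>F h in at_right 0. dist (T h x) x < e" using \<open>0 < e\<close> by (rule tendstoD)
    then obtain d where d: "0 < d" "\<And>h. 0 < h \<Longrightarrow> h < d \<Longrightarrow> dist (T h x) x < e"
      by (auto simp: eventually_at_right_field)
    have "dist (T s x) (T t x) < e" if s: "0 \<le> s" "dist s t < d" for s
    proof -
      consider "s < t" | "s = t" | "t < s" by linarith
      then show ?thesis
      proof cases
        case 1
        then show ?thesis using incr[of s t] d(2)[of "t - s"] s t by (auto simp: dist_commute dist_real_def)
      next
        case 3
        then show ?thesis using incr[of t s] d(2)[of "s - t"] s t by (auto simp: dist_real_def)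
      qed (use \<open>0 < e\<close> in auto)
    qed
    then show "\<exists>d>0. \<forall>s\<in>{0..}. dist s t < d \<longrightarrow> dist (T s x) (T t x) < e"
      using d(1) by auto
  qed
qed

locale nonexpansive_modes =
  fixes N :: nat and S :: "nat \<Rightarrow> real \<Rightarrow> 'a::banach \<Rightarrow>\<^sub>L 'a"
  assumes two_modes: "2 \<le> N"
    and semigroup: "i \<in> {1..N} \<Longrightarrow> C0_semigroup (S i)"
    and contraction: "i \<in> {1..N} \<Longrightarrow> 0 \<le> t \<Longrightarrow> norm (S i t) \<le> 1"
begin

lemmas mode_add = C0_semigroup_add[OF semigroup]
lemmas mode_zero = C0_semigroup_zero[OF semigroup]

lemma norm_mode_le:
  assumes "i \<in> {1..N}" "0 \<le> t"
  shows "norm (S i t x) \<le> norm x"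
proof -
  have "norm (S i t x) \<le> norm (S i t) * norm x" by (rule norm_blinfun)
  also have "\<dots> \<le> 1 * norm x" using contraction[OF assms] by (intro mult_right_mono) auto
  finally show ?thesis by simp
qed

lemma mode_continuous: "i \<in> {1..N} \<Longrightarrow> continuous_on {0..} (\<lambda>t. S i t x)"
  by (intro C0_semigroup_continuous semigroup contraction)

lemma mode_tendsto:
  assumes "i \<in> {1..N}"
  shows "((\<lambda>t. S i t x) \<longlongrightarrow> x) (at_right 0)"
  using semigroup[OF assms] by (simp add: C0_semigroup_def)

lemma compose_modes_induct:
  assumes "sorted ts" "set ts \<subseteq> {s..t}" "s \<le> t" "0 \<le> s" "\<And>u. 0 \<le> u \<Longrightarrow> \<eta> u \<in> {1..N}"
    and base: "\<And>i d. i \<in> {1..N} \<Longrightarrow> 0 \<le> d \<Longrightarrow> P d (S i d)"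
    and step: "\<And>i d e U. i \<in> {1..N} \<Longrightarrow> 0 \<le> d \<Longrightarrow> 0 \<le> e \<Longrightarrow> P e U \<Longrightarrow> P (d + e) (U o\<^sub>L S i d)"
  shows "P (t - s) (compose_modes S \<eta> t s ts)"
  using assms(1-4)
proof (induction ts arbitrary: s)
  case Nil
  then show ?case using base assms(5) by simp
next
  case (Cons u us)
  then have "P (t - u) (compose_modes S \<eta> t u us)" by (intro Cons.IH) auto
  then have "P ((u - s) + (t - u)) (compose_modes S \<eta> t u us o\<^sub>L S (\<eta> s) (u - s))"
    using Cons.prems assms(5) by (intro step) auto
  then show ?case by simp
qed

text \<open>
  An evolution operator is a product of mode operators whose durations add up to \<open>t - s\<close>.
  Estimates in terms of the elapsed time alone can therefore be proved without reference to the
  signal: it is enough that they hold for a single mode and survive one more factor.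
\<close>

lemma evolution_induct [consumes 3, case_names base step]:
  assumes \<eta>: "\<eta> \<in> signals N" and "0 \<le> s" "s \<le> t"
    and base: "\<And>i d. i \<in> {1..N} \<Longrightarrow> 0 \<le> d \<Longrightarrow> P d (S i d)"
    and step: "\<And>i d e U. i \<in> {1..N} \<Longrightarrow> 0 \<le> d \<Longrightarrow> 0 \<le> e \<Longrightarrow> P e U \<Longrightarrow> P (d + e) (U o\<^sub>L S i d)"
  shows "P (t - s) (evolution S \<eta> t s)"
proof -
  obtain \<tau> i where r: "realizes N \<eta> \<tau> i" using \<eta> by (auto simp: signals_iff_realizes)
  show ?thesis
    unfolding evolution_def
  proof (rule compose_modes_induct[where P = P])
    show "set (sorted_list_of_set (switching_instants \<eta> \<inter> {s<..t})) \<subseteq> {s..t}"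
      using finite_switching[OF \<eta>, of s t] by auto
  qed (fact assms realizes_mode[OF r] sorted_sorted_list_of_set)+
qed

lemma norm_evolution_le:
  assumes "\<eta> \<in> signals N" "0 \<le> s" "s \<le> t"
  shows "norm (evolution S \<eta> t s x) \<le> norm x"
proof -
  have "\<forall>x. norm (evolution S \<eta> t s x) \<le> norm x"
    using assms
  proof (rule evolution_induct[where P = "\<lambda>_ U. \<forall>x. norm (U x) \<le> norm x"])
    show "\<forall>x. norm ((U o\<^sub>L S i d) x) \<le> norm x"
      if "i \<in> {1..N}" "0 \<le> d" "\<forall>x. norm (U x) \<le> norm x" for i d and U :: "'a \<Rightarrow>\<^sub>L 'a"
      using norm_mode_le[OF that(1,2)] that(3) by (auto intro: order_trans)
  qed (simp add: norm_mode_le)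
  then show ?thesis by simp
qed

text \<open>
  The end of an interval on which the signal is constant may or may not be a switching instant.
  In the first case the claim is the recursion of \<open>compose_modes\<close>. In the second case mode
  \<open>j\<close> is active beyond \<open>u\<close>, and the semigroup law splits its operator at \<open>u\<close>.
\<close>

lemma evolution_first_mode:
  assumes const: "\<And>v. s \<le> v \<Longrightarrow> v < u \<Longrightarrow> \<eta> v = j" and j: "j \<in> {1..N}"
    and su: "0 \<le> s" "s < u" "u \<le> t" and fin: "finite (switching_instants \<eta> \<inter> {s<..t})"
  shows "evolution S \<eta> t s = evolution S \<eta> t u o\<^sub>L S j (u - s)"
proof -
  let ?I = "\<lambda>s. switching_instants \<eta> \<inter> {s<..t}"
  have none: "v \<notin> switching_instants \<eta>" if "s < v" "v < u" for v
    using const su that by (intro not_switching_within_constant[of s u \<eta> j v]) auto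
  have "\<eta> s = j" using const su by simp
  have fin': "finite (?I u)" by (rule finite_subset[OF _ fin]) (use su in auto)
  show ?thesis
  proof (cases "u \<in> switching_instants \<eta>")
    case True
    have "?I s = insert u (?I u)" using True none su by force
    moreover have "sorted_list_of_set (insert u (?I u)) = u # sorted_list_of_set (?I u)"
      using fin' sorted_list_of_set.idem_if_sorted_distinct[of "u # sorted_list_of_set (?I u)"] by (simp add: less_imp_le)
    ultimately show ?thesis using \<open>\<eta> s = j\<close> by (simp add: evolution_def)
  next
    case False
    have "u < v" if "v \<in> ?I s" for v
      using none[of v] False that by (cases v u rule: linorder_cases) auto
    then have "?I s = ?I u" using su by force
    have "\<eta> u = j" using const su False by (intro not_switching_right_end[of s u \<eta> j]) auto
    have split: "S j (v - s) = S j (v - u) o\<^sub>L S j (u - s)" if "u \<le> v" for v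
      using mode_add[OF j, of "v - u" "u - s"] su that by simp
    have "compose_modes S \<eta> t s vs = compose_modes S \<eta> t u vs o\<^sub>L S j (u - s)"
      if "\<forall>v\<in>set vs. u \<le> v" for vs
      using that split[of t] split[of "hd vs"] \<open>\<eta> s = j\<close> \<open>\<eta> u = j\<close> su
      by (cases vs) (simp_all add: blinfun_compose_assoc)
    moreover have "\<forall>v\<in>set (sorted_list_of_set (?I u)). u \<le> v" using fin' by auto
    ultimately show ?thesis by (simp add: evolution_def \<open>?I s = ?I u\<close>)
  qed
qed

lemma evolution_delay_head:
  assumes "\<eta> \<in> signals N" "j \<in> {1..N}" "0 < h" "0 \<le> t" "t < h"
  shows "evolution S (delay j h \<eta>) t 0 = S j t"
proof -
  have "v \<notin> switching_instants (delay j h \<eta>)" if "v \<in> {0<..t}" for v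
    using assms that by (intro not_switching_within_constant[of 0 h _ j]) (auto simp: delay_def)
  then have "switching_instants (delay j h \<eta>) \<inter> {0<..t} = {}" by blast
  then show ?thesis using assms by (simp add: evolution_def) (simp add: delay_def)
qed

lemma evolution_delay:
  assumes "\<eta> \<in> signals N" "j \<in> {1..N}" "0 < h" "0 \<le> t"
  shows "evolution S (delay j h \<eta>) (t + h) 0 = evolution S \<eta> t 0 o\<^sub>L S j h"
proof -
  have "evolution S (delay j h \<eta>) (t + h) 0 = evolution S (delay j h \<eta>) (t + h) h o\<^sub>L S j (h - 0)"
    using assms finite_switching[OF delay_in_signals[OF assms(1-3)]]
    by (intro evolution_first_mode) (auto simp: delay_def)
  then show ?thesis by (simp add: evolution_delay_tail[OF assms(3)])
qed

text \<open>
  The evolution from time \<open>0\<close> to the switching time \<open>\<tau> k\<close>.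
\<close>

fun switch_product :: "(nat \<Rightarrow> real) \<Rightarrow> (nat \<Rightarrow> nat) \<Rightarrow> nat \<Rightarrow> 'a \<Rightarrow>\<^sub>L 'a" where
  "switch_product \<tau> i 0 = id_blinfun"
| "switch_product \<tau> i (Suc k) = S (i k) (\<tau> (Suc k) - \<tau> k) o\<^sub>L switch_product \<tau> i k"

lemma evolution_from_switch:
  assumes r: "realizes N \<eta> \<tau> i" and "\<tau> k \<le> t"
  shows "evolution S \<eta> t 0 = evolution S \<eta> t (\<tau> k) o\<^sub>L switch_product \<tau> i k"
  using assms(2)
proof (induction k)
  case 0
  then show ?case using r by (auto simp: realizes_def intro: blinfun_eqI)
next
  case (Suc k)
  have "\<tau> k < \<tau> (Suc k)" "i k \<in> {1..N}" using r by (auto simp: realizes_def)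
  moreover have "finite (switching_instants \<eta> \<inter> {\<tau> k<..t})"
    using r by (intro finite_switching[of _ N]) (auto simp: signals_iff_realizes)
  ultimately have "evolution S \<eta> t (\<tau> k) = evolution S \<eta> t (\<tau> (Suc k)) o\<^sub>L S (i k) (\<tau> (Suc k) - \<tau> k)"
    using realizes_value[OF r, of k] realizes_nonneg[OF r] Suc.prems
    by (intro evolution_first_mode) auto
  then show ?case using Suc \<open>\<tau> k < \<tau> (Suc k)\<close> by (simp add: blinfun_compose_assoc)
qed

lemma evolution_on_piece:
  assumes r: "realizes N \<eta> \<tau> i" and t: "\<tau> k \<le> t" "t < \<tau> (Suc k)"
  shows "evolution S \<eta> t 0 = S (i k) (t - \<tau> k) o\<^sub>L switch_product \<tau> i k"
proof -
  have "v \<notin> switching_instants \<eta>" if "v \<in> {\<tau> k<..t}" for v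
    using that t realizes_value[OF r, of k] realizes_nonneg[OF r]
    by (intro not_switching_within_constant[of "\<tau> k" "\<tau> (Suc k)" _ "i k"]) auto
  then have "switching_instants \<eta> \<inter> {\<tau> k<..t} = {}" by blast
  moreover have "\<eta> (\<tau> k) = i k" using realizes_value[OF r, of k] t by simp
  ultimately show ?thesis using evolution_from_switch[OF r t(1)] by (simp add: evolution_def)
qed

text \<open>
  Between two switching times the trajectory is an orbit of a single semigroup, so it is
  continuous on each of countably many intervals that cover the time axis.
\<close>

lemma cost_integrand_measurable:
  assumes "\<eta> \<in> signals N"
  shows "(\<lambda>t. ennreal (norm (evolution S \<eta> t 0 x) powr p) * indicator {0..} t) \<in> borel_measurable borel"
proof -
  obtain \<tau> i where r: "realizes N \<eta> \<tau> i" using assms by (auto simp: signals_iff_realizes)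
  define A where "A k = (case k of 0 \<Rightarrow> {..<0} | Suc n \<Rightarrow> {\<tau> n..<\<tau> (Suc n)})" for k
  let ?f = "\<lambda>t. ennreal (norm (evolution S \<eta> t 0 x) powr p) * indicator {0..} t"
  show ?thesis
  proof (rule measurable_piecewise_restrict2[where A = A])
    show "A k \<in> sets borel" for k by (cases k) (auto simp: A_def)
    have "t \<in> (\<Union>k. A k)" for t
    proof (cases "t < 0")
      case True
      then show ?thesis by (intro UN_I[of 0]) (auto simp: A_def)
    next
      case False
      then obtain k where "\<tau> k \<le> t" "t < \<tau> (Suc k)" using realizes_cover[OF r, of t] by force
      then show ?thesis by (intro UN_I[of "Suc k"]) (auto simp: A_def)
    qed
    then show "space borel = (\<Union>k. A k)" by auto
    fix k
    show "\<exists>h\<in>borel_measurable borel. \<forall>t\<in>A k. ?f t = h t"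
    proof (cases k)
      case 0
      then show ?thesis by (intro bexI[of _ "\<lambda>_. 0"]) (auto simp: A_def)
    next
      case (Suc n)
      have "i n \<in> {1..N}" using r by (auto simp: realizes_def)
      \<comment> \<open>Clamping at 0 extends the orbit to a function that is continuous on the whole line.\<close>
      have "continuous_on UNIV (\<lambda>t. S (i n) (max 0 (t - \<tau> n)) (switch_product \<tau> i n x))"
        by (rule continuous_on_compose2[OF mode_continuous[OF \<open>i n \<in> {1..N}\<close>]])
          (auto intro!: continuous_intros)
      then have [measurable]: "(\<lambda>t. S (i n) (max 0 (t - \<tau> n)) (switch_product \<tau> i n x)) \<in> borel_measurable borel"
        by (rule borel_measurable_continuous_onI)
      have "?f t = ennreal (norm (S (i n) (max 0 (t - \<tau> n)) (switch_product \<tau> i n x)) powr p)"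
        if "t \<in> A k" for t
        using that Suc evolution_on_piece[OF r, of n t] realizes_nonneg[OF r, of n] by (auto simp: A_def)
      then show ?thesis
        by (intro bexI[of _ "\<lambda>t. ennreal (norm (S (i n) (max 0 (t - \<tau> n)) (switch_product \<tau> i n x)) powr p)"]) auto
    qed
  qed
qed

section \<open>Exponential decay from uniform stability\<close>

lemma alternating_in_signals: "0 < h \<Longrightarrow> alternating h \<in> signals N"
  using alternating_realizes[OF two_modes] by (auto simp: signals_iff_realizes)

lemma switch_count_alternating:
  assumes "0 < h"
  shows "switch_count (alternating h) (real n * h) 0 = n"
proof -
  have "switching_instants (alternating h) \<inter> {0<..real n * h} = (\<lambda>k. real k * h) ` {1..n}"
    using assms by (auto simp: switching_instants_eq[OF alternating_realizes[OF two_modes assms]])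
  moreover have "inj_on (\<lambda>k. real k * h) {1..n}" using assms by (simp add: inj_on_def)
  ultimately show ?thesis by (simp add: switch_count_def card_image)
qed

text \<open>
  Each of the \<open>n\<close> contractions moves the point by at most \<open>\<delta>\<close> in addition to what has been
  accumulated before.
\<close>

lemma alternating_evolution_close:
  assumes "0 < h" and close: "\<And>i. i \<in> {1..N} \<Longrightarrow> norm (S i h x - x) \<le> \<delta>"
  shows "norm (evolution S (alternating h) (real n * h) 0 x - x) \<le> real n * \<delta>"
proof -
  let ?\<tau> = "\<lambda>k. real k * h" and ?i = "\<lambda>k. if even k then 1 else 2 :: nat"
  note r = alternating_realizes[OF two_modes \<open>0 < h\<close>]
  have mode: "?i k \<in> {1..N}" for k using two_modes by auto
  have "evolution S (alternating h) (?\<tau> n) 0 = S (?i n) 0 o\<^sub>L switch_product ?\<tau> ?i n"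
    using evolution_on_piece[OF r, of n "?\<tau> n"] assms by (simp add: algebra_simps)
  then have "evolution S (alternating h) (?\<tau> n) 0 x = switch_product ?\<tau> ?i n x"
    by (simp only: mode_zero[OF mode]) simp
  moreover have "norm (switch_product ?\<tau> ?i n x - x) \<le> real n * \<delta>"
  proof (induction n)
    case (Suc n)
    let ?y = "switch_product ?\<tau> ?i n x"
    have "switch_product ?\<tau> ?i (Suc n) x - x = S (?i n) h (?y - x) + (S (?i n) h x - x)"
      by (simp add: algebra_simps blinfun.diff_right)
    also have "norm \<dots> \<le> norm (S (?i n) h (?y - x)) + norm (S (?i n) h x - x)"
      by (rule norm_triangle_ineq)
    also have "\<dots> \<le> norm (?y - x) + \<delta>"
      using mode[of n] assms by (intro add_mono norm_mode_le close) auto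
    finally show ?case using Suc by (simp add: algebra_simps)
  qed simp
  ultimately show ?thesis by simp
qed

text \<open>
  Decay in the number of switches alone is incompatible with a nonzero point \<open>x\<close>: for each \<open>n\<close>
  there is an alternating signal that performs \<open>n\<close> switches so fast that at least half of the norm
  of \<open>x\<close> is left, and hence \<open>1 / 2 \<le> M * \<rho> ^ n\<close>.
\<close>

lemma switch_decay_imp_trivial:
  fixes x :: 'a
  assumes \<rho>: "0 \<le> \<rho>" "\<rho> < 1"
    and decay: "\<And>\<eta> t. \<eta> \<in> signals N \<Longrightarrow> 0 \<le> t \<Longrightarrow> norm (evolution S \<eta> t 0) \<le> M * \<rho> ^ switch_count \<eta> t 0"
  shows "x = 0"
proof (rule ccontr)
  assume "x \<noteq> 0"
  have lower: "1 / 2 \<le> M * \<rho> ^ n" for n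
  proof -
    define \<delta> where "\<delta> = norm x / (2 * (real n + 1))"
    have "0 < \<delta>" using \<open>x \<noteq> 0\<close> by (simp add: \<delta>_def)
    have "\<forall>\<^sub>F h in at_right 0. norm (S i h x - x) < \<delta>" if "i \<in> {1..N}" for i
      using tendstoD[OF mode_tendsto[OF that] \<open>0 < \<delta>\<close>] by (simp add: dist_norm)
    then have "\<forall>\<^sub>F h in at_right 0. \<forall>i\<in>{1..N}. norm (S i h x - x) < \<delta>"
      by (intro eventually_ball_finite) auto
    then have "\<forall>\<^sub>F h in at_right 0. 0 < h \<and> (\<forall>i\<in>{1..N}. norm (S i h x - x) < \<delta>)"
      by (intro eventually_conj) (simp_all add: eventually_at_right_less)
    then obtain h where h: "0 < h" "\<And>i. i \<in> {1..N} \<Longrightarrow> norm (S i h x - x) < \<delta>"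
      using eventually_happens'[OF trivial_limit_at_right_real] by blast
    let ?U = "evolution S (alternating h) (real n * h) 0"
    have "norm (?U x - x) \<le> real n * \<delta>"
      using h by (intro alternating_evolution_close) (auto simp: less_imp_le)
    also have "\<dots> \<le> norm x / 2" by (simp add: \<delta>_def field_simps)
    finally have "norm x / 2 \<le> norm (?U x)" using norm_triangle_ineq2[of x "?U x"] by (simp add: norm_minus_commute)
    also have "\<dots> \<le> norm ?U * norm x" by (rule norm_blinfun)
    also have "\<dots> \<le> (M * \<rho> ^ n) * norm x"
      using decay[OF alternating_in_signals[OF h(1)], of "real n * h"] h(1)
      by (intro mult_right_mono) (auto simp: switch_count_alternating)
    finally show ?thesis using \<open>x \<noteq> 0\<close> by (simp add: field_simps)
  qed
  have "(\<lambda>n. M * \<rho> ^ n) \<longlonglongrightarrow> M * 0"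
    using \<rho> by (intro tendsto_intros LIMSEQ_power_zero) auto
  then have "1 / 2 \<le> M * 0" by (rule LIMSEQ_le_const) (use lower in auto)
  then show False by simp
qed

lemma UGES_imp_exp_decay:
  assumes "UGES S (signals N)"
  obtains M \<alpha> where "1 \<le> M" "0 < \<alpha>"
    "\<And>\<eta> t. \<eta> \<in> signals N \<Longrightarrow> 0 \<le> t \<Longrightarrow> norm (evolution S \<eta> t 0) \<le> M * exp (- \<alpha> * t)"
proof -
  obtain M \<alpha> \<rho> where M: "1 \<le> M" "0 \<le> \<alpha>" "0 < \<rho>" "\<rho> \<le> 1" "\<alpha> - ln \<rho> > 0"
    and decay: "\<And>\<eta> s t. \<eta> \<in> signals N \<Longrightarrow> 0 \<le> s \<Longrightarrow> s \<le> t \<Longrightarrow>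
      norm (evolution S \<eta> t s) \<le> M * \<rho> ^ switch_count \<eta> t s * exp (- \<alpha> * (t - s))"
    using assms unfolding UGES_def by blast
  show thesis
  proof (cases "0 < \<alpha>")
    case True
    show ?thesis
    proof (rule that[OF M(1) True])
      fix \<eta> t assume "\<eta> \<in> signals N" "0 \<le> (t::real)"
      then have "norm (evolution S \<eta> t 0) \<le> M * \<rho> ^ switch_count \<eta> t 0 * exp (- \<alpha> * t)"
        using decay[of \<eta> 0 t] by simp
      also have "\<dots> \<le> M * 1 * exp (- \<alpha> * t)"
        using M by (intro mult_right_mono mult_left_mono power_le_one) auto
      finally show "norm (evolution S \<eta> t 0) \<le> M * exp (- \<alpha> * t)" by simp
    qed
  next
    case False
    then have "\<alpha> = 0" "\<rho> < 1" using M by (auto simp: less_le)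
    have "x = 0" for x :: 'a
      using M \<open>\<rho> < 1\<close> \<open>\<alpha> = 0\<close> decay[of _ 0]
      by (intro switch_decay_imp_trivial[of \<rho> M]) auto
    \<comment> \<open>On the trivial space every operator is zero, so any constants will do.\<close>
    then have zero: "norm U = 0" for U :: "'a \<Rightarrow>\<^sub>L 'a" by (metis blinfun_eqI norm_zero)
    show ?thesis by (rule that[of 1 1]) (simp_all only: zero, simp_all)
  qed
qed

section \<open>The functional given by the worst-case cost\<close>

definition cost :: "real \<Rightarrow> (real \<Rightarrow> nat) \<Rightarrow> 'a \<Rightarrow> ennreal" where
  "cost p \<eta> x = (\<integral>\<^sup>+t\<in>{0..}. ennreal (norm (evolution S \<eta> t 0 x) powr p) \<partial>lborel)"

lemma sup_functional_eq: "sup_functional N S p x = (SUP \<eta>\<in>signals N. cost p \<eta> x)"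
  by (simp add: sup_functional_def cost_def)

text \<open>
  The cost of the delayed signal is the cost of the original signal started in \<open>S j h x\<close>, plus
  the cost of the run of mode \<open>j\<close>. On that run the norm is nonincreasing, so it stays above its
  final value.
\<close>

lemma cost_delay_ge:
  assumes \<eta>: "\<eta> \<in> signals N" and j: "j \<in> {1..N}" and h: "0 < h" and p: "0 \<le> p"
  shows "cost p \<eta> (S j h x) + ennreal (h * norm (S j h x) powr p) \<le> cost p (delay j h \<eta>) x"
proof -
  let ?y = "S j h x"
  let ?f = "\<lambda>t. ennreal (norm (evolution S \<eta> t 0 ?y) powr p) * indicator {0..} t"
  note [measurable] = cost_integrand_measurable[OF \<eta>]
  have "cost p \<eta> ?y = (\<integral>\<^sup>+t. ?f (-h + 1 * t) \<partial>lborel)"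
    unfolding cost_def
    by (subst nn_integral_real_affine[OF cost_integrand_measurable[OF \<eta>], of 1 _ _ "-h"]) simp_all
  moreover have "ennreal (h * norm ?y powr p) = (\<integral>\<^sup>+t. ennreal (norm ?y powr p) * indicator {0..<h} t \<partial>lborel)"
    using h by (subst nn_integral_cmult_indicator) (simp_all add: ennreal_mult[symmetric] mult.commute)
  ultimately have "cost p \<eta> ?y + ennreal (h * norm ?y powr p)
      = (\<integral>\<^sup>+t. ?f (-h + 1 * t) \<partial>lborel) + (\<integral>\<^sup>+t. ennreal (norm ?y powr p) * indicator {0..<h} t \<partial>lborel)"
    by simp
  also have "\<dots> = (\<integral>\<^sup>+t. ?f (-h + 1 * t) + ennreal (norm ?y powr p) * indicator {0..<h} t \<partial>lborel)"
    by (intro nn_integral_add[symmetric]) measurable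
  also have "\<dots> \<le> cost p (delay j h \<eta>) x"
    unfolding cost_def
  proof (rule nn_integral_mono)
    fix t :: real
    consider "t < 0" | "0 \<le> t" "t < h" | "h \<le> t" by linarith
    then show "?f (-h + 1 * t) + ennreal (norm ?y powr p) * indicator {0..<h} t
        \<le> ennreal (norm (evolution S (delay j h \<eta>) t 0 x) powr p) * indicator {0..} t"
    proof cases
      case 2
      have "?y = S j (h - t) (S j t x)" using mode_add[OF j, of "h - t" t] 2 by simp
      then have "norm ?y \<le> norm (S j t x)" using 2 j by (simp add: norm_mode_le)
      then show ?thesis
        using 2 evolution_delay_head[OF \<eta> j h, of t] p by (auto intro!: ennreal_leI powr_mono2)
    next
      case 3
      then show ?thesis using h evolution_delay[OF \<eta> j h, of "t - h"] by simp
    qed (use h in auto)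
  qed
  finally show ?thesis .
qed

context
  fixes M \<alpha> p :: real
  assumes M: "0 < M" and \<alpha>: "0 < \<alpha>" and p: "1 \<le> p"
    and decay: "\<And>\<eta> t. \<eta> \<in> signals N \<Longrightarrow> 0 \<le> t \<Longrightarrow> norm (evolution S \<eta> t 0) \<le> M * exp (- \<alpha> * t)"
begin

lemma norm_evolution_decay:
  assumes "\<eta> \<in> signals N" "0 \<le> t"
  shows "norm (evolution S \<eta> t 0 x) \<le> M * exp (- \<alpha> * t) * norm x"
  using norm_blinfun[of "evolution S \<eta> t 0" x] mult_right_mono[OF decay[OF assms], of "norm x"] by simp

text \<open>
  One factor of the power decays exponentially, the other \<open>p - 1\<close> are bounded by contractivity.
  This makes the bound \<open>M / \<alpha>\<close> independent of \<open>p\<close>.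
\<close>

lemma cost_le:
  assumes \<eta>: "\<eta> \<in> signals N"
  shows "cost p \<eta> x \<le> ennreal (M / \<alpha> * norm x powr p)"
proof -
  have "cost p \<eta> x \<le> (\<integral>\<^sup>+t\<in>{0..}. ennreal (M * norm x powr p * exp (- \<alpha> * t)) \<partial>lborel)"
    unfolding cost_def
  proof (intro nn_integral_mono)
    fix t :: real
    have "norm (evolution S \<eta> t 0 x) powr p \<le> M * norm x powr p * exp (- \<alpha> * t)" if "0 \<le> t"
    proof -
      let ?a = "norm (evolution S \<eta> t 0 x)"
      have "?a powr p = ?a * ?a powr (p - 1)" by (simp add: powr_mult_base)
      also have "\<dots> \<le> (M * exp (- \<alpha> * t) * norm x) * norm x powr (p - 1)"
        using norm_evolution_decay[OF \<eta> that] norm_evolution_le[OF \<eta>, of 0 t] that p M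
        by (intro mult_mono powr_mono2) auto
      also have "\<dots> = M * exp (- \<alpha> * t) * (norm x * norm x powr (p - 1))" by simp
      also have "norm x * norm x powr (p - 1) = norm x powr p" by (simp add: powr_mult_base)
      finally show ?thesis by (simp add: mult_ac)
    qed
    then show "ennreal (norm (evolution S \<eta> t 0 x) powr p) * indicator {0..} t
        \<le> ennreal (M * norm x powr p * exp (- \<alpha> * t)) * indicator {0..} t"
      by (auto simp: indicator_def intro: ennreal_leI)
  qed
  also have "\<dots> = ennreal (M * norm x powr p / \<alpha>)" using M \<alpha> by (intro nn_integral_exp_decay) auto
  finally show ?thesis by simp
qed

text \<open>
  The trajectory of \<open>x\<close> stays in the ball of radius \<open>r\<close>, so that \<open>powr_le_add_linear\<close> applies at
  each time, and the distance of the two trajectories decays exponentially.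
\<close>

lemma cost_lipschitz:
  assumes \<eta>: "\<eta> \<in> signals N" and x: "norm x \<le> r"
  shows "cost p \<eta> x \<le> cost p \<eta> y + ennreal (p * r powr (p - 1) * M / \<alpha> * norm (x - y))"
proof -
  let ?K = "p * r powr (p - 1) * M * norm (x - y)"
  have "0 \<le> ?K" using p M by simp
  have "cost p \<eta> x \<le> (\<integral>\<^sup>+t. ennreal (norm (evolution S \<eta> t 0 y) powr p) * indicator {0..} t
      + ennreal (?K * exp (- \<alpha> * t)) * indicator {0..} t \<partial>lborel)"
    unfolding cost_def
  proof (intro nn_integral_mono)
    fix t :: real
    have "norm (evolution S \<eta> t 0 x) powr p \<le> norm (evolution S \<eta> t 0 y) powr p + ?K * exp (- \<alpha> * t)" if "0 \<le> t"
    proof -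
      let ?a = "norm (evolution S \<eta> t 0 x)" and ?b = "norm (evolution S \<eta> t 0 y)"
      have "?a \<le> r" using norm_evolution_le[OF \<eta>, of 0 t x] that x by simp
      then have growth: "?a powr p \<le> ?b powr p + p * r powr (p - 1) * \<bar>?a - ?b\<bar>"
        using p by (intro powr_le_add_linear) auto
      have "\<bar>?a - ?b\<bar> \<le> norm (evolution S \<eta> t 0 (x - y))"
        using norm_triangle_ineq3 by (simp add: blinfun.diff_right)
      also have "\<dots> \<le> M * exp (- \<alpha> * t) * norm (x - y)" by (rule norm_evolution_decay[OF \<eta> that])
      finally have "\<bar>?a - ?b\<bar> \<le> M * exp (- \<alpha> * t) * norm (x - y)" .
      then have "p * r powr (p - 1) * \<bar>?a - ?b\<bar> \<le> p * r powr (p - 1) * (M * exp (- \<alpha> * t) * norm (x - y))"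
        using p by (intro mult_left_mono) auto
      with growth show ?thesis by (simp add: mult_ac)
    qed
    then show "ennreal (norm (evolution S \<eta> t 0 x) powr p) * indicator {0..} t
        \<le> ennreal (norm (evolution S \<eta> t 0 y) powr p) * indicator {0..} t
           + ennreal (?K * exp (- \<alpha> * t)) * indicator {0..} t"
      using \<open>0 \<le> ?K\<close> by (auto simp: indicator_def ennreal_plus[symmetric] simp del: ennreal_plus intro: ennreal_leI)
  qed
  also have "\<dots> = cost p \<eta> y + (\<integral>\<^sup>+t\<in>{0..}. ennreal (?K * exp (- \<alpha> * t)) \<partial>lborel)"
    unfolding cost_def
    by (intro nn_integral_add) (use cost_integrand_measurable[OF \<eta>] in simp_all)
  also have "(\<integral>\<^sup>+t\<in>{0..}. ennreal (?K * exp (- \<alpha> * t)) \<partial>lborel) = ennreal (?K / \<alpha>)"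
    using \<alpha> \<open>0 \<le> ?K\<close> by (rule nn_integral_exp_decay)
  finally show ?thesis by (simp add: mult_ac)
qed

lemma sup_functional_le: "sup_functional N S p x \<le> ennreal (M / \<alpha> * norm x powr p)"
  unfolding sup_functional_eq by (intro SUP_least cost_le)

lemma sup_functional_finite: "sup_functional N S p x < \<infinity>"
  using sup_functional_le[of x] by (simp add: order.strict_trans1)

abbreviation V where "V x \<equiv> enn2real (sup_functional N S p x)"

lemma ennreal_V: "ennreal (V x) = sup_functional N S p x"
  using sup_functional_finite[of x] by simp

lemma cost_le_V: "\<eta> \<in> signals N \<Longrightarrow> cost p \<eta> x \<le> ennreal (V x)"
  by (metis SUP_upper ennreal_V sup_functional_eq)

lemma V_lipschitz:
  assumes "norm x \<le> r"
  shows "V x \<le> V y + p * r powr (p - 1) * M / \<alpha> * norm (x - y)"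
proof -
  let ?L = "p * r powr (p - 1) * M / \<alpha> * norm (x - y)"
  have "0 \<le> ?L" using p M \<alpha> by simp
  have "sup_functional N S p x \<le> ennreal (V y) + ennreal ?L"
    unfolding sup_functional_eq[of p x]
    by (intro SUP_least order_trans[OF cost_lipschitz[OF _ assms, of _ y]] add_right_mono cost_le_V)
  then have "ennreal (V x) \<le> ennreal (V y + ?L)"
    using \<open>0 \<le> ?L\<close> by (simp add: ennreal_V)
  then show ?thesis using \<open>0 \<le> ?L\<close> by (subst (asm) ennreal_le_iff) auto
qed

text \<open>
  A dynamic programming inequality: running mode \<open>j\<close> for time \<open>h\<close> and continuing with a nearly
  worst signal from \<open>S j h x\<close> cannot cost more than the worst signal from \<open>x\<close>.
\<close>

lemma V_decrease:
  assumes j: "j \<in> {1..N}" and h: "0 < h"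
  shows "V (S j h x) + h * norm (S j h x) powr p \<le> V x"
proof -
  let ?q = "h * norm (S j h x) powr p"
  have "0 \<le> ?q" using h by simp
  have each: "cost p \<eta> (S j h x) \<le> ennreal (V x - ?q) \<and> ?q \<le> V x" if \<eta>: "\<eta> \<in> signals N" for \<eta>
  proof -
    have "cost p \<eta> (S j h x) < \<infinity>" using cost_le_V[OF \<eta>] by (rule order.strict_trans1) simp
    then obtain r where r: "cost p \<eta> (S j h x) = ennreal r" "0 \<le> r"
      by (metis ennreal_cases infinity_ennreal_def less_irrefl)
    have "ennreal r + ennreal ?q \<le> ennreal (V x)"
      unfolding r(1)[symmetric] using p
      by (intro order_trans[OF cost_delay_ge[OF \<eta> j h]] cost_le_V delay_in_signals[OF \<eta> j h]) auto
    then have "r + ?q \<le> V x"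
      using r(2) \<open>0 \<le> ?q\<close> by (simp add: ennreal_plus[symmetric] del: ennreal_plus)
    then show ?thesis using r by (auto intro: ennreal_leI)
  qed
  have "sup_functional N S p (S j h x) \<le> ennreal (V x - ?q)"
    unfolding sup_functional_eq[of p "S j h x"] using each by (intro SUP_least) auto
  \<comment> \<open>Some signal is needed here, as the supremum over no signals would be 0.\<close>
  moreover have "?q \<le> V x" using each[OF alternating_in_signals[of 1]] by simp
  ultimately have "V (S j h x) \<le> V x - ?q" by (intro enn2real_leI) auto
  then show ?thesis by simp
qed

lemma V_common_functional: "common_functional N S p (M / \<alpha>) V"
  unfolding common_functional_def
proof (intro conjI allI ballI)
  show "V x \<le> M / \<alpha> * norm x powr p" for x
    using sup_functional_le[of x] M \<alpha> by (intro enn2real_leI) auto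
  show "lipschitz_on_bounded V"
    unfolding lipschitz_on_bounded_def
  proof (intro allI impI)
    fix r :: real assume "0 < r"
    let ?L = "p * r powr (p - 1) * M / \<alpha>"
    have "0 < ?L" using p M \<alpha> \<open>0 < r\<close> by simp
    moreover have "?L-lipschitz_on (ball 0 r) V"
    proof (rule lipschitz_onI)
      fix x y :: 'a assume "x \<in> ball 0 r" "y \<in> ball 0 r"
      then show "dist (V x) (V y) \<le> ?L * dist x y"
        using V_lipschitz[of x r y] V_lipschitz[of y r x]
        by (simp add: dist_norm norm_minus_commute abs_le_iff)
    qed (use \<open>0 < ?L\<close> in simp)
    ultimately show "\<exists>L>0. L-lipschitz_on (ball 0 r) V" by blast
  qed
  fix x :: 'a and i assume i: "i \<in> {1..N}"
  have "\<forall>\<^sub>F h in at_right 0. ereal ((V (S i h x) - V x) / h) \<le> ereal (- (norm (S i h x) powr p))"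
    using eventually_at_right_less[of 0]
  proof eventually_elim
    case (elim h)
    then show ?case using V_decrease[OF i elim, of x] by (simp add: field_simps)
  qed
  then have "lower_dini (S i) V x \<le> Liminf (at_right 0) (\<lambda>h. ereal (- (norm (S i h x) powr p)))"
    unfolding lower_dini_def by (rule Liminf_mono)
  also have "((\<lambda>h. ereal (- (norm (S i h x) powr p))) \<longlongrightarrow> ereal (- (norm x powr p))) (at_right 0)"
    using p by (intro tendsto_intros tendsto_powr' mode_tendsto[OF i]) auto
  then have "Liminf (at_right 0) (\<lambda>h. ereal (- (norm (S i h x) powr p))) = ereal (- (norm x powr p))"
    by (intro lim_imp_Liminf) simp_all
  finally show "lower_dini (S i) V x \<le> ereal (- (norm x powr p))" .
qed simp

end

section \<open>Uniform stability from a common functional\<close>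

context
  fixes p c :: real and V :: "'a \<Rightarrow> real"
  assumes p: "1 \<le> p" and c: "0 < c" and V: "common_functional N S p c V"
begin

lemma V_nonneg: "0 \<le> V x" and V_le: "V x \<le> c * norm x powr p"
  using V by (auto simp: common_functional_def)

lemma V_continuous: "continuous_on UNIV V"
proof -
  have "isCont V x" for x
  proof -
    obtain L where "L-lipschitz_on (ball 0 (norm x + 1)) V"
      using V unfolding common_functional_def lipschitz_on_bounded_def
      by (meson add_nonneg_pos norm_ge_zero zero_less_one)
    then have "continuous_on (ball 0 (norm x + 1)) V" by (rule lipschitz_on_continuous_on)
    then show ?thesis by (simp add: continuous_on_eq_continuous_at)
  qed
  then show ?thesis by (simp add: continuous_at_imp_continuous_on)
qed

text \<open>
  Throughout, \<open>q\<close> stands for the power of the norm at the final time, a lower bound for the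
  powers of the norm at all earlier times. Hence \<open>V\<close> and the constant \<open>c * q\<close> added to it are
  both at most \<open>c\<close> times the current power, and the factor \<open>2\<close> in the rate makes room for both.
\<close>

lemma mode_weighted_decrease:
  assumes i: "i \<in> {1..N}" and T: "0 \<le> T"
  shows "exp (T / (2 * c)) * (V (S i T x) + c * norm (S i T x) powr p) \<le> V x + c * norm (S i T x) powr p"
proof -
  define \<alpha> where "\<alpha> = 1 / (2 * c)"
  define q where "q = norm (S i T x) powr p"
  define g where "g t = exp (\<alpha> * t) * (V (S i t x) + c * q)" for t
  have "continuous_on {0..T} (\<lambda>t. V (S i t x))"
    using mode_continuous[OF i, of x]
    by (intro continuous_on_compose2[OF V_continuous]) (auto intro: continuous_on_subset)
  then have "continuous_on {0..T} g" unfolding g_def by (intro continuous_intros)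
  moreover have "\<exists>\<^sub>F h in at_right 0. g (t + h) \<le> g t + \<epsilon> * h" if t: "0 \<le> t" "t < T" and "0 < \<epsilon>" for t \<epsilon>
  proof -
    define y where "y = S i t x"
    \<comment> \<open>The factor \<open>exp (\<alpha> * t)\<close> comes out of the difference quotient, so it is divided out first.\<close>
    define e where "e = \<epsilon> / exp (\<alpha> * t)"
    have "0 < e" using \<open>0 < \<epsilon>\<close> by (simp add: e_def)
    \<comment> \<open>At the point \<open>y\<close> the exponential factor grows no faster than \<open>V\<close> decreases.\<close>
    have "S i T x = S i (T - t) y" using mode_add[OF i, of "T - t" t] t by (simp add: y_def)
    then have "q \<le> norm y powr p"
      unfolding q_def using norm_mode_le[OF i, of "T - t" y] t p by (intro powr_mono2) auto
    then have "\<alpha> * (V y + c * q) \<le> \<alpha> * (c * norm y powr p + c * norm y powr p)"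
      using V_le[of y] c by (intro mult_left_mono add_mono) (auto simp: \<alpha>_def)
    also have "\<dots> = norm y powr p" using c by (simp add: \<alpha>_def)
    finally have rate: "\<alpha> * (V y + c * q) \<le> norm y powr p" .
    have "((\<lambda>h. exp (\<alpha> * h)) has_real_derivative \<alpha>) (at 0)"
      by (auto intro!: derivative_eq_intros)
    then have "((\<lambda>h. (exp (\<alpha> * h) - 1) / h) \<longlongrightarrow> \<alpha>) (at 0)" by (simp add: DERIV_def)
    then have "((\<lambda>h. (exp (\<alpha> * h) - 1) / h) \<longlongrightarrow> \<alpha>) (at_right 0)"
      by (rule filterlim_at_split[THEN iffD1, THEN conjunct2])
    moreover have "((\<lambda>h. V (S i h y)) \<longlongrightarrow> V y) (at_right 0)"
      using V_continuous by (intro isCont_tendsto_compose[OF _ mode_tendsto[OF i]])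
        (simp add: continuous_on_eq_continuous_at)
    ultimately have "((\<lambda>h. (exp (\<alpha> * h) - 1) / h * (V (S i h y) + c * q)) \<longlongrightarrow> \<alpha> * (V y + c * q)) (at_right 0)"
      by (intro tendsto_intros)
    then have "\<forall>\<^sub>F h in at_right 0. (exp (\<alpha> * h) - 1) / h * (V (S i h y) + c * q) < norm y powr p + e / 2"
      by (rule order_tendstoD) (use rate \<open>0 < e\<close> in auto)
    then have ev: "\<forall>\<^sub>F h in at_right 0. 0 < h \<and> (exp (\<alpha> * h) - 1) / h * (V (S i h y) + c * q) < norm y powr p + e / 2"
      by (intro eventually_conj) (simp_all add: eventually_at_right_less)
    have "lower_dini (S i) V y \<le> ereal (- (norm y powr p))"
      using V i by (auto simp: common_functional_def)
    then have fr: "\<exists>\<^sub>F h in at_right 0. (V (S i h y) - V y) / h < - (norm y powr p) + e / 2"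
      unfolding lower_dini_def by (rule frequently_less_of_Liminf) (use \<open>0 < e\<close> in simp)
    have "\<exists>\<^sub>F h in at_right 0. (V (S i h y) - V y) / h < - (norm y powr p) + e / 2 \<and>
        0 < h \<and> (exp (\<alpha> * h) - 1) / h * (V (S i h y) + c * q) < norm y powr p + e / 2"
      by (rule frequently_eventually_frequently[OF fr ev])
    then show ?thesis
    proof (rule frequently_elim1, elim conjE)
      fix h :: real assume "0 < h" and "(V (S i h y) - V y) / h < - (norm y powr p) + e / 2"
        and "(exp (\<alpha> * h) - 1) / h * (V (S i h y) + c * q) < norm y powr p + e / 2"
      then have "(V (S i h y) - V y) / h + (exp (\<alpha> * h) - 1) / h * (V (S i h y) + c * q) \<le> e" by linarith
      then have "((V (S i h y) - V y) / h + (exp (\<alpha> * h) - 1) / h * (V (S i h y) + c * q)) * h \<le> e * h"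
        using \<open>0 < h\<close> by (intro mult_right_mono) auto
      also have "((V (S i h y) - V y) / h + (exp (\<alpha> * h) - 1) / h * (V (S i h y) + c * q)) * h
          = exp (\<alpha> * h) * (V (S i h y) + c * q) - (V y + c * q)"
        using \<open>0 < h\<close> by (simp add: field_simps)
      finally have "exp (\<alpha> * h) * (V (S i h y) + c * q) - (V y + c * q) \<le> e * h" .
      then have "exp (\<alpha> * t) * (exp (\<alpha> * h) * (V (S i h y) + c * q) - (V y + c * q)) \<le> exp (\<alpha> * t) * (e * h)"
        by (intro mult_left_mono) auto
      moreover have "g (t + h) = exp (\<alpha> * t) * (exp (\<alpha> * h) * (V (S i h y) + c * q))"
        using mode_add[OF i, of h t] t \<open>0 < h\<close>
        by (simp add: g_def y_def add.commute distrib_left exp_add)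
      moreover have "g t = exp (\<alpha> * t) * (V y + c * q)" by (simp add: g_def y_def)
      ultimately show "g (t + h) \<le> g t + \<epsilon> * h"
        by (simp add: e_def right_diff_distrib)
    qed
  qed
  ultimately have "g T \<le> g 0" using T by (intro nonincreasing_of_lower_dini[of 0 T g]) auto
  then show ?thesis using mode_zero[OF i] by (simp add: g_def q_def \<alpha>_def)
qed

text \<open>
  The final value changes from one mode to the composition, but passing from \<open>norm y powr p\<close> to the
  smaller \<open>norm z powr p\<close> subtracts at least as much on the left, where it carries an
  exponential factor, as on the right.
\<close>

lemma evolution_weighted_decrease:
  assumes "\<eta> \<in> signals N" "0 \<le> s" "s \<le> t"
  shows "exp ((t - s) / (2 * c)) * (V (evolution S \<eta> t s x) + c * norm (evolution S \<eta> t s x) powr p)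
     \<le> V x + c * norm (evolution S \<eta> t s x) powr p"
proof -
  define P where "P d U \<longleftrightarrow> (\<forall>x. exp (d / (2 * c)) * (V (U x) + c * norm (U x) powr p) \<le> V x + c * norm (U x) powr p
      \<and> norm (U x) \<le> norm x)" for d and U :: "'a \<Rightarrow>\<^sub>L 'a"
  have "P (t - s) (evolution S \<eta> t s)"
    using assms
  proof (rule evolution_induct)
    show "P d (S i d)" if "i \<in> {1..N}" "0 \<le> d" for i d
      using that by (simp add: P_def mode_weighted_decrease norm_mode_le)
    fix i and d e :: real and U :: "'a \<Rightarrow>\<^sub>L 'a" assume i: "i \<in> {1..N}" "0 \<le> d" "0 \<le> e" and U: "P e U"
    show "P (d + e) (U o\<^sub>L S i d)"
      unfolding P_def
    proof (intro allI conjI)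
      fix x
      let ?y = "S i d x" and ?z = "U (S i d x)"
      have zy: "norm ?z \<le> norm ?y" using U by (simp add: P_def)
      then show "norm ((U o\<^sub>L S i d) x) \<le> norm x" using norm_mode_le[OF i(1,2), of x] by simp
      have "norm ?z powr p \<le> norm ?y powr p" using zy p by (intro powr_mono2) auto
      then have gap: "0 \<le> c * (norm ?y powr p - norm ?z powr p)" using c by simp
      have "exp ((d + e) / (2 * c)) * (V ?z + c * norm ?z powr p)
          = exp (d / (2 * c)) * (exp (e / (2 * c)) * (V ?z + c * norm ?z powr p))"
        by (simp add: add_divide_distrib exp_add)
      also have "\<dots> \<le> exp (d / (2 * c)) * (V ?y + c * norm ?z powr p)"
        using U by (intro mult_left_mono) (auto simp: P_def)
      also have "\<dots> = exp (d / (2 * c)) * (V ?y + c * norm ?y powr p)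
          - exp (d / (2 * c)) * (c * (norm ?y powr p - norm ?z powr p))"
        by (simp add: algebra_simps)
      also have "\<dots> \<le> (V x + c * norm ?y powr p) - 1 * (c * (norm ?y powr p - norm ?z powr p))"
        using i c gap by (intro diff_mono mode_weighted_decrease mult_right_mono) auto
      also have "\<dots> = V x + c * norm ?z powr p" by (simp add: algebra_simps)
      finally show "exp ((d + e) / (2 * c)) * (V ((U o\<^sub>L S i d) x) + c * norm ((U o\<^sub>L S i d) x) powr p)
          \<le> V x + c * norm ((U o\<^sub>L S i d) x) powr p" by simp
    qed
  qed
  then show ?thesis by (simp add: P_def)
qed

lemma norm_evolution_exp_decay:
  assumes \<eta>: "\<eta> \<in> signals N" "0 \<le> s" "s \<le> t"
  shows "norm (evolution S \<eta> t s) \<le> 2 * exp (- (1 / (2 * c * p)) * (t - s))"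
proof (rule norm_blinfun_bound)
  fix x
  let ?z = "evolution S \<eta> t s x" and ?E = "exp ((t - s) / (2 * c))"
  have "?E * (c * norm ?z powr p) \<le> ?E * (V ?z + c * norm ?z powr p)"
    by (simp add: V_nonneg)
  also have "\<dots> \<le> V x + c * norm ?z powr p" by (rule evolution_weighted_decrease[OF \<eta>])
  also have "\<dots> \<le> c * norm x powr p + c * norm x powr p"
    using V_le[of x] norm_evolution_le[OF \<eta>, of x] c p by (intro add_mono mult_left_mono powr_mono2) auto
  finally have "c * (?E * norm ?z powr p) \<le> c * (2 * norm x powr p)" by (simp add: mult_ac)
  then have "?E * norm ?z powr p \<le> 2 * norm x powr p" using c by simp
  \<comment> \<open>A constant that is uniform in \<open>p\<close>, so that taking the root gives the factor \<open>2\<close>.\<close>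
  also have "\<dots> \<le> 2 powr p * norm x powr p"
    using p powr_mono[of 1 p 2] by (intro mult_right_mono) auto
  finally have "norm ?z powr p \<le> 2 powr p * norm x powr p * exp (- ((t - s) / (2 * c)))"
    by (simp add: exp_minus field_simps)
  also have "\<dots> = (2 * exp (- (1 / (2 * c * p)) * (t - s)) * norm x) powr p"
    using p c by (simp add: powr_mult exp_powr_real field_simps)
  finally have le: "norm ?z powr p \<le> (2 * exp (- (1 / (2 * c * p)) * (t - s)) * norm x) powr p" .
  show "norm ?z \<le> 2 * exp (- (1 / (2 * c * p)) * (t - s)) * norm x"
  proof (rule ccontr)
    assume "\<not> ?thesis"
    then have "(2 * exp (- (1 / (2 * c * p)) * (t - s)) * norm x) powr p < norm ?z powr p"
      using p by (intro powr_less_mono2) auto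
    with le show False by simp
  qed
qed simp

lemma common_functional_imp_UGES: "UGES S (signals N)"
  unfolding UGES_def
  using norm_evolution_exp_decay p c
  by (intro exI[of _ 2] exI[of _ "1 / (2 * c * p)"] exI[of _ 1]) auto

end

end

theorem theorem7p7:
  fixes N :: nat
    and S :: "nat \<Rightarrow> real \<Rightarrow> 'a::banach \<Rightarrow>\<^sub>L 'a"
    and D :: "nat \<Rightarrow> 'a set"
    and A :: "nat \<Rightarrow> 'a \<Rightarrow> 'a"
  assumes "N \<ge> 2"
    and "\<forall>i\<in>{1..N}. generates (D i) (A i) (S i)"
    and "\<forall>i\<in>{1..N}. \<forall>j\<in>{1..N}. D i = D j"
    and "\<forall>i\<in>{1..N}. \<forall>t\<ge>0. norm (S i t) \<le> 1"
  shows "(UGES S (signals N) \<longleftrightarrow>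
            (\<exists>p\<ge>1. \<exists>c>0. \<exists>V. common_functional N S p c V)) \<and>
         (UGES S (signals N) \<longrightarrow>
            (\<forall>p\<ge>1. (\<forall>x. sup_functional N S p x < \<infinity>) \<and>
               (\<exists>c>0. common_functional N S p c (\<lambda>x. enn2real (sup_functional N S p x)))))"
proof -
  interpret nonexpansive_modes N S
    using assms(1,2,4) by unfold_locales (simp_all add: generates_def)
  have sup: "\<forall>p\<ge>1. (\<forall>x. sup_functional N S p x < \<infinity>) \<and>
      (\<exists>c>0. common_functional N S p c (\<lambda>x. enn2real (sup_functional N S p x)))"
    if uges: "UGES S (signals N)"
  proof -
    obtain M \<alpha> where M: "1 \<le> M" "0 < \<alpha>" and decay: "\<And>\<eta> t. \<eta> \<in> signals N \<Longrightarrow> 0 \<le> t \<Longrightarrow>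
        norm (evolution S \<eta> t 0) \<le> M * exp (- \<alpha> * t)"
      using UGES_imp_exp_decay[OF uges] by blast
    have "0 < M" "0 < M / \<alpha>" using M by auto
    then show ?thesis
      using sup_functional_finite[OF _ M(2) _ decay] V_common_functional[OF _ M(2) _ decay] by blast
  qed
  then have "\<exists>p\<ge>1. \<exists>c>0. \<exists>V. common_functional N S p c V" if "UGES S (signals N)"
    using that by (meson order_refl)
  with sup show ?thesis using common_functional_imp_UGES by blast
qed

end
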